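(* Let $d,k\ge 1$ be integers, let $\mathbf{u}$ and $\mathbf{v}_1,\dots,\mathbf{v}_k$ be $\mathbb{R}^d$-valued random vectors (the target and the basis language models) defined on a common probability space, with mean zero and finite second moments. Put $\mathbf{z}=[\mathbf{v}_1^\top,\mathbf{v}_2^\top,\dots,\mathbf{v}_k^\top]^\top$, an $\mathbb{R}^{kd}$-valued random vector. For $\mathbf{W}=[\mathbf{W}_1,\dots,\mathbf{W}_k]\in\mathbb{R}^{d\times kd}$ with blocks $\mathbf{W}_i\in\mathbb{R}^{d\times d}$, let $$L(\mathbf{W})=\operatorname{E}\Big[\big\|\mathbf{u}-\sum_{i=1}^k\mathbf{W}_i\mathbf{v}_i\big\|^2\Big]=\operatorname{E}\big[\|\mathbf{u}-\mathbf{W}\mathbf{z}\|^2\big].$$ Then: (1) If the matrix $\operatorname{E}[\mathbf{z}\mathbf{z}^\top]\in\mathbb{R}^{kd\times kd}$ has full rank, then $L$ has a unique global minimizer over $\mathbb{R}^{d\times kd}$, namely $$\mathbf{W}=\operatorname{E}[\mathbf{u}\mathbf{z}^\top]\,\big(\operatorname{E}[\mathbf{z}\mathbf{z}^\top]\big)^{-1}.$$ (2) If $\operatorname{E}[\mathbf{z}\mathbf{z}^\top]$ does not have full rank, then $L$ is convex but not strictly convex, it has infinitely many global minimizers over $\mathbb{R}^{d\times kd}$, and the global minimizer of minimum Frobenius norm is $$\mathbf{W}=\operatorname{E}[\mathbf{u}\mathbf{z}^\top]\,\big(\operatorname{E}[\mathbf{z}\mathbf{z}^\top]\big)^{+}.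$$
   Context: A language model is viewed as a vector-valued function $\mathbf{u}:\Omega\to\mathbb{R}^d$ on a space $\Omega$ of text sequences; here $\Omega$ carries a probability distribution, so that language models are $\mathbb{R}^d$-valued random vectors, and $\operatorname{E}$ denotes expectation over $x\in\Omega$. $\|\cdot\|$ is the Euclidean ($L_2$) norm on $\mathbb{R}^d$. $\mathbf{A}^{+}$ denotes the Moore–Penrose inverse of a matrix $\mathbf{A}$. Expectations of random matrices are taken entrywise. *)

theory Defs
  imports "HOL-Probability.Probability"
begin

text \<open>The dimension \<open>d\<close> is \<open>CARD('d)\<close> and the number \<open>k\<close> of basis models is \<open>CARD('k)\<close>. Block
  vectors in dimension \<open>k d\<close> are indexed by the product type \<open>'k \<times> 'd\<close>: the coordinate \<open>(i, b)\<close> is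
  the \<open>b\<close>-th coordinate of the \<open>i\<close>-th block.\<close>

definition stack :: "('k::finite \<Rightarrow> real^'d) \<Rightarrow> real^('k \<times> 'd::finite)" where
  "stack v = (\<chi> p. v (fst p) $ snd p)"

definition block :: "real^('k \<times> 'd)^'d \<Rightarrow> 'k::finite \<Rightarrow> real^'d^'d::finite" where
  "block W i = (\<chi> a b. W $ a $ (i, b))"

definition outer :: "real^'m \<Rightarrow> real^'n \<Rightarrow> real^'n^'m" where
  "outer x y = (\<chi> i j. x $ i * y $ j)"

definition expectation_mat :: "'w measure \<Rightarrow> ('w \<Rightarrow> real^'n^'m) \<Rightarrow> real^'n^'m" where
  "expectation_mat M X = (\<chi> i j. prob_space.expectation M (\<lambda>\<omega>. X \<omega> $ i $ j))"

definition loss ::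
  "'w measure \<Rightarrow> ('w \<Rightarrow> real^'d) \<Rightarrow> ('k::finite \<Rightarrow> 'w \<Rightarrow> real^'d) \<Rightarrow> real^('k \<times> 'd)^'d \<Rightarrow> real" where
  "loss M u v W =
     prob_space.expectation M (\<lambda>\<omega>. (norm (u \<omega> - (\<Sum>i\<in>UNIV. block W i *v v i \<omega>)))\<^sup>2)"

definition strictly_convex_on :: "'a::real_vector set \<Rightarrow> ('a \<Rightarrow> real) \<Rightarrow> bool" where
  "strictly_convex_on S f \<longleftrightarrow> convex S \<and>
     (\<forall>x\<in>S. \<forall>y\<in>S. \<forall>t. x \<noteq> y \<longrightarrow> 0 < t \<longrightarrow> t < 1 \<longrightarrow>
        f ((1 - t) *\<^sub>R x + t *\<^sub>R y) < (1 - t) * f x + t * f y)"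

text \<open>The four Penrose conditions; they determine \<open>X\<close> uniquely, see \<open>ex1_penrose\<close> below.\<close>

definition penrose :: "real^'n^'m \<Rightarrow> real^'m^'n \<Rightarrow> bool" where
  "penrose A X \<longleftrightarrow> A ** X ** A = A \<and> X ** A ** X = X \<and>
     transpose (A ** X) = A ** X \<and> transpose (X ** A) = X ** A"

definition moore_penrose :: "real^'n^'m \<Rightarrow> real^'m^'n" where
  "moore_penrose A = (THE X. penrose A X)"

lemma sum_block_mult: "(\<Sum>i\<in>UNIV. block W i *v v i) = W *v stack v"
  by (simp add: vec_eq_iff matrix_vector_mult_def block_def stack_def sum.cartesian_product
      case_prod_beta)

lemma loss_eq_stack:
  "loss M u v W =
     prob_space.expectation M (\<lambda>\<omega>. (norm (u \<omega> - W *v stack (\<lambda>i. v i \<omega>)))\<^sup>2)"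
  unfolding loss_def by (simp add: sum_block_mult[of W "\<lambda>i. v i _"])

text \<open>The library norm on matrices is the Frobenius norm (not the operator norm).\<close>

lemma norm_matrix_eq_frobenius:
  fixes A :: "real^'n^'m"
  shows "norm A = sqrt (\<Sum>i\<in>UNIV. \<Sum>j\<in>UNIV. (A $ i $ j)\<^sup>2)"
  by (simp add: norm_vec_def L2_set_def sum_nonneg)

lemma ex_inner_inverse:
  fixes A :: "real^'n^'m"
  obtains G where "A ** G ** A = A"
proof -
  obtain g where g: "linear g" "\<forall>y\<in>range ((*v) A). A *v g y = y"
    using linear_exists_right_inverse_on[of "(*v) A" UNIV] by auto
  have "A ** matrix g ** A = A"
    using g by (simp add: matrix_eq matrix_vector_mul_assoc[symmetric] matrix_works)
  then show thesis by (rule that)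
qed

lemma matrix_mul_diff_ldistrib:
  fixes A :: "real^'n^'m"
  shows "A ** (B - C) = A ** B - A ** C"
  by (simp add: vec_eq_iff matrix_matrix_mult_def sum_subtractf right_diff_distrib)

lemma gram_eq_0:
  fixes D :: "real^'n^'m"
  assumes "transpose D ** D = 0"
  shows "D = 0"
proof -
  have "D *v x = 0" for x
  proof -
    have "(D *v x) \<bullet> (D *v x) = x \<bullet> ((transpose D ** D) *v x)"
      by (metis dot_lmul_matrix matrix_vector_mul_assoc inner_commute transpose_matrix_vector)
    then show ?thesis using assms by simp
  qed
  then show ?thesis by (simp add: matrix_eq)
qed

lemma ex_least_squares_inverse:
  fixes A :: "real^'n^'m"
  obtains X where "A ** X ** A = A" "transpose (A ** X) = A ** X"
proof -
  let ?T = "transpose A"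
  obtain G where G: "(?T ** A) ** G ** (?T ** A) = ?T ** A" by (rule ex_inner_inverse)
  have *: "A ** H ** ?T ** A = A" if H: "(?T ** A) ** H ** (?T ** A) = ?T ** A" for H
  proof -
    define D where "D = A ** H ** ?T ** A - A"
    have 0: "?T ** D = 0"
      using H by (simp add: D_def matrix_mul_diff_ldistrib matrix_mul_assoc)
    have D: "D = A ** (H ** ?T ** A - mat 1)"
      by (simp add: D_def matrix_mul_diff_ldistrib matrix_mul_assoc)
    have "transpose D ** D = transpose (H ** ?T ** A - mat 1) ** (?T ** D)"
      by (subst (1) D) (simp add: matrix_transpose_mul matrix_mul_assoc)
    also have "\<dots> = 0" by (simp only: 0) (simp add: matrix_matrix_mult_def vec_eq_iff)
    finally have "D = 0" by (rule gram_eq_0)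
    then show ?thesis by (simp add: D_def)
  qed
  have "(?T ** A) ** transpose G ** (?T ** A) = ?T ** A"
    using arg_cong[OF G, of transpose] by (simp add: matrix_transpose_mul matrix_mul_assoc)
  note 1 = *[OF G] and 2 = *[OF this]
  have "transpose (A ** G ** ?T) ** (A ** G ** ?T) = A ** G ** ?T"
    using 2 by (simp add: matrix_transpose_mul matrix_mul_assoc)
  then have "transpose (A ** G ** ?T) = A ** G ** ?T"
    by (metis matrix_transpose_mul transpose_transpose)
  with 1 show thesis by (intro that[of "G ** ?T"]) (simp_all add: matrix_mul_assoc)
qed

lemma ex1_penrose:
  fixes A :: "real^'n^'m"
  shows "\<exists>!X. penrose A X"
proof (rule ex_ex1I)
  obtain X where X: "A ** X ** A = A" "transpose (A ** X) = A ** X"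
    by (rule ex_least_squares_inverse)
  obtain Y' where Y': "transpose A ** Y' ** transpose A = transpose A"
    "transpose (transpose A ** Y') = transpose A ** Y'"
    by (rule ex_least_squares_inverse)
  define Y where "Y = transpose Y'"
  have Y: "A ** Y ** A = A" "transpose (Y ** A) = Y ** A"
    using arg_cong[OF Y'(1), of transpose] Y'(2)
    by (simp_all add: Y_def matrix_transpose_mul matrix_mul_assoc)
  have "A ** (Y ** A ** X) = A ** X" "(Y ** A ** X) ** A = Y ** A"
    using X(1) Y(1) by (metis matrix_mul_assoc)+
  then have "penrose A (Y ** A ** X)"
    using X Y unfolding penrose_def by (metis matrix_mul_assoc)
  then show "\<exists>X. penrose A X" ..
next
  fix X Y assume "penrose A X" "penrose A Y"
  then have X: "A ** X ** A = A" "X ** A ** X = X"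
      "transpose (A ** X) = A ** X" "transpose (X ** A) = X ** A"
    and Y: "A ** Y ** A = A" "Y ** A ** Y = Y"
      "transpose (A ** Y) = A ** Y" "transpose (Y ** A) = Y ** A"
    by (auto simp: penrose_def)
  have "A ** X = transpose ((A ** Y) ** (A ** X))"
    using X(3) Y(1) by (simp add: matrix_mul_assoc)
  also have "\<dots> = (A ** X) ** (A ** Y)"
    by (simp only: matrix_transpose_mul[of "A ** Y"] X(3) Y(3))
  also have "\<dots> = A ** Y" using X(1) by (simp add: matrix_mul_assoc)
  finally have 1: "A ** X = A ** Y" .
  have "X ** A = transpose ((X ** A) ** (Y ** A))"
    using X(4) Y(1) by (metis matrix_mul_assoc)
  also have "\<dots> = (Y ** A) ** (X ** A)"
    by (simp only: matrix_transpose_mul[of "X ** A"] X(4) Y(4))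
  also have "\<dots> = Y ** A" using X(1) by (metis matrix_mul_assoc)
  finally have 2: "X ** A = Y ** A" .
  show "X = Y" using 1 2 X(2) Y(2) by (metis matrix_mul_assoc)
qed

end

theory Submission
  imports Defs
begin

text \<open>With \<open>S = E[z z\<^sup>T]\<close>, \<open>C = E[u z\<^sup>T]\<close> and the Frobenius inner product, the loss is the quadratic
  \<open>c - 2 (W \<bullet> C) + W \<bullet> W S\<close>. Since it is nonnegative, restricting it to lines gives, through the
  discriminant, that \<open>D \<bullet> D S \<ge> 0\<close> and that \<open>D S = 0\<close> forces \<open>D \<bullet> C = 0\<close>; the minimizers are exactly the
  solutions of the normal equation \<open>W S = C\<close>. Applied to \<open>D = C P\<close>, where \<open>P = I - S\<^sup>+ S\<close> is the projection
  onto the kernel of \<open>S\<close>, this yields \<open>C P = 0\<close>, that is, \<open>C S\<^sup>+\<close> solves the normal equation. Any other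
  solution differs from \<open>C S\<^sup>+\<close> by some \<open>D\<close> with \<open>D S = 0\<close>, which is orthogonal to \<open>C S\<^sup>+\<close>.\<close>

section \<open>Outer products, the Frobenius inner product and integrability\<close>

lemma inner_outer: "W \<bullet> outer x y = x \<bullet> (W *v y)"
  by (simp add: inner_vec_def outer_def matrix_vector_mult_def sum_distrib_left mult_ac)

lemma inner_matrix_mult_right:
  fixes A :: "real^'n^'m" and B :: "real^'p^'n"
  shows "(A ** B) \<bullet> C = A \<bullet> (C ** transpose B)"
proof -
  have "(A ** B) \<bullet> C = (\<Sum>i\<in>UNIV. \<Sum>j\<in>UNIV. \<Sum>k\<in>UNIV. A $ i $ k * B $ k $ j * C $ i $ j)"
    by (simp add: inner_vec_def matrix_matrix_mult_def sum_distrib_right)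
  also have "\<dots> = (\<Sum>i\<in>UNIV. \<Sum>k\<in>UNIV. \<Sum>j\<in>UNIV. A $ i $ k * B $ k $ j * C $ i $ j)"
    by (intro sum.cong refl sum.swap)
  also have "\<dots> = A \<bullet> (C ** transpose B)"
    by (simp add: inner_vec_def matrix_matrix_mult_def transpose_def sum_distrib_left mult_ac)
  finally show ?thesis .
qed

lemma bounded_bilinear_outer: "bounded_bilinear outer"
  unfolding bilinear_conv_bounded_bilinear[symmetric] bilinear_def
  by (auto simp: outer_def vec_eq_iff algebra_simps intro!: linearI)

text \<open>Finite second moments enter here: boundedness of the bilinear map and
  \<open>a b \<le> a\<^sup>2 + b\<^sup>2\<close> dominate the outer product by an integrable
  function.\<close>

lemma integrable_outer:
  fixes x :: "'w \<Rightarrow> real^'m" and y :: "'w \<Rightarrow> real^'n"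
  assumes [measurable]: "x \<in> borel_measurable M" "y \<in> borel_measurable M"
    and ix: "integrable M (\<lambda>\<omega>. (norm (x \<omega>))\<^sup>2)" and iy: "integrable M (\<lambda>\<omega>. (norm (y \<omega>))\<^sup>2)"
  shows "integrable M (\<lambda>\<omega>. outer (x \<omega>) (y \<omega>))"
proof -
  obtain K where K: "0 \<le> K" "\<And>a b. norm (outer a b :: real^'n^'m) \<le> norm a * norm b * K"
    using bounded_bilinear.nonneg_bounded[OF bounded_bilinear_outer] by blast
  have [measurable]: "(\<lambda>\<omega>. outer (x \<omega>) (y \<omega>)) \<in> borel_measurable M"
    by (rule borel_measurable_continuous_Pair[OF assms(1,2)],
        rule bounded_bilinear.continuous_on[OF bounded_bilinear_outer])
      (rule continuous_on_fst continuous_on_snd continuous_on_id)+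
  have le: "norm (outer a b :: real^'n^'m) \<le> K * ((norm a)\<^sup>2 + (norm b)\<^sup>2)" for a b
  proof -
    have "norm a * norm b \<le> (norm a)\<^sup>2 + (norm b)\<^sup>2"
      using sum_squares_bound[of "norm a" "norm b"]
        mult_nonneg_nonneg[OF norm_ge_zero[of a] norm_ge_zero[of b]] by linarith
    then have "norm a * norm b * K \<le> ((norm a)\<^sup>2 + (norm b)\<^sup>2) * K"
      using K(1) by (rule mult_right_mono)
    with K(2)[of a b] show ?thesis by (simp add: mult.commute)
  qed
  show ?thesis
    by (rule Bochner_Integration.integrable_bound[of M "\<lambda>\<omega>. K * ((norm (x \<omega>))\<^sup>2 + (norm (y \<omega>))\<^sup>2)"])
      (use ix iy in \<open>auto intro!: order.trans[OF le]\<close>)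
qed

text \<open>Allows bounded linear maps to be pulled through the expectation. Integrability matters:
  otherwise the Bochner integral of the whole matrix defaults to 0, but entrywise only the
  nonintegrable entries do.\<close>

lemma expectation_mat_eq_integral:
  assumes "integrable M X"
  shows "expectation_mat M X = integral\<^sup>L M X"
proof -
  have "(integral\<^sup>L M X) $ i $ j = (\<integral>\<omega>. X \<omega> $ i $ j \<partial>M)" for i j
    using integral_bounded_linear[OF bounded_linear_compose[OF bounded_linear_vec_nth bounded_linear_vec_nth] assms]
    by simp
  then show ?thesis by (simp add: expectation_mat_def vec_eq_iff)
qed

lemma norm_stack_sq: "(norm (stack v))\<^sup>2 = (\<Sum>i\<in>UNIV. (norm (v i))\<^sup>2)"
  by (simp add: power2_norm_eq_inner inner_vec_def stack_def sum.cartesian_product case_prod_beta)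

lemma borel_measurable_stack:
  assumes "\<And>i. v i \<in> borel_measurable M"
  shows "(\<lambda>\<omega>. stack (\<lambda>i. v i \<omega>)) \<in> borel_measurable M"
proof -
  have "(\<lambda>\<omega>. stack (\<lambda>i. v i \<omega>) \<bullet> axis p 1) \<in> borel_measurable M" for p
  proof -
    have "(\<lambda>\<omega>. v (fst p) \<omega> \<bullet> axis (snd p) 1) \<in> borel_measurable M"
      by (rule borel_measurable_inner[OF assms borel_measurable_const])
    then show ?thesis by (simp add: inner_axis stack_def)
  qed
  then show ?thesis by (subst borel_measurable_euclidean_space) (auto simp: Basis_vec_def)
qed

text \<open>Used below in the degenerate cases: \<open>b = 0\<close> follows from
  \<open>a = 0\<close> as well as from \<open>c = 0\<close>.\<close>

lemma quadratic_nonneg_discriminant: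
  fixes a b c :: real
  assumes nonneg: "\<And>t. 0 \<le> c + b * t + a * t\<^sup>2"
  shows "0 \<le> a" "b\<^sup>2 \<le> 4 * a * c"
proof -
  show a: "0 \<le> a"
  proof (rule ccontr)
    assume a: "\<not> 0 \<le> a"
    \<comment> \<open>With this choice \<open>a * t\<^sup>2\<close> is
      \<open>- \<bar>c\<bar> - 1\<close>; adding the values at \<open>t\<close> and
      \<open>- t\<close> cancels the linear term and leaves a negative number.\<close>
    define t where "t = sqrt ((\<bar>c\<bar> + 1) / - a)"
    have "t\<^sup>2 = (\<bar>c\<bar> + 1) / - a"
      unfolding t_def by (rule real_sqrt_pow2, rule divide_nonneg_nonneg) (use a in auto)
    then have "a * t\<^sup>2 = - \<bar>c\<bar> - 1" using a by (simp add: field_simps)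
    then show False using nonneg[of t] nonneg[of "- t"] by simp
  qed
  show "b\<^sup>2 \<le> 4 * a * c"
  proof (cases "a = 0")
    case True
    \<comment> \<open>For \<open>b \<noteq> 0\<close> the affine function takes the value
      \<open>-1\<close> at this point.\<close>
    have "b = 0" using nonneg[of "- (c + 1) / b"] True by (cases "b = 0") auto
    then show ?thesis using True by simp
  next
    case False
    \<comment> \<open>The value at the vertex, scaled by \<open>4 * a\<close> to clear
      denominators.\<close>
    have "0 \<le> (c + b * (- b / (2 * a)) + a * (- b / (2 * a))\<^sup>2) * (4 * a)"
      by (rule mult_nonneg_nonneg[OF nonneg]) (use a in simp)
    also have "\<dots> = 4 * a * c - b\<^sup>2" using False by (simp add: field_simps power2_eq_square)
    finally show ?thesis by simp
  qed
qed

section \<open>Least squares for an abstract nonnegative quadratic\<close>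

lemma matrix_mult_diff_rdistrib: "((A :: real^'n^'m) - B) ** C = A ** C - B ** C"
  by (simp add: matrix_matrix_mult_def vec_eq_iff sum_subtractf left_diff_distrib)

lemma bilinear_matrix_mult: "bilinear ((**) :: real^'n^'m \<Rightarrow> real^'p^'n \<Rightarrow> real^'p^'m)"
  by (auto simp: bilinear_def matrix_matrix_mult_def vec_eq_iff algebra_simps sum.distrib
      sum_distrib_left intro!: linearI)

text \<open>Probability is abstracted away: positive semidefiniteness of \<open>S\<close> and
  solvability of \<open>W ** S = C\<close> are derived from nonnegativity of
  \<open>L\<close>.\<close>

locale least_squares_quadratic =
  fixes L :: "real^'n^'m \<Rightarrow> real" and S :: "real^'n^'n" and C :: "real^'n^'m" and c :: real
  assumes L_eq: "L W = c - 2 * (W \<bullet> C) + W \<bullet> (W ** S)"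
    and L_nonneg: "0 \<le> L W"
    and sym_S: "transpose S = S"
begin

lemma form_commute: "V \<bullet> (W ** S) = W \<bullet> (V ** S)"
  using inner_matrix_mult_right[of V S W] sym_S by (simp add: inner_commute)

text \<open>The exact Taylor expansion along a line; \<open>2 (W S - C)\<close> is the gradient.
  Symmetry of \<open>S\<close> merges the two cross terms.\<close>

lemma L_line: "L (W + t *\<^sub>R D) = L W + 2 * (D \<bullet> (W ** S - C)) * t + (D \<bullet> (D ** S)) * t\<^sup>2"
proof -
  note bl = bilinear_matrix_mult
  have "(W + t *\<^sub>R D) ** S = W ** S + t *\<^sub>R (D ** S)"
    by (simp add: bilinear_ladd[OF bl] bilinear_lmul[OF bl])
  then show ?thesis
    by (simp add: L_eq inner_add_left inner_add_right inner_diff_right form_commute[of W D]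
        algebra_simps power2_eq_square)
qed

lemma form_nonneg:
  fixes D :: "real^'n^'m"
  shows "0 \<le> D \<bullet> (D ** S)"
proof (rule quadratic_nonneg_discriminant(1))
  show "0 \<le> L 0 + 2 * (D \<bullet> (0 ** S - C)) * t + (D \<bullet> (D ** S)) * t\<^sup>2" for t
    using L_nonneg[of "0 + t *\<^sub>R D"] by (simp only: L_line)
qed

text \<open>On the line through 0 in direction \<open>D\<close> the loss is affine with slope
  \<open>-2 (D \<bullet> C)\<close>, and a nonnegative affine function is constant.\<close>

lemma inner_C_eq_0:
  fixes D :: "real^'n^'m"
  assumes "D ** S = 0"
  shows "D \<bullet> C = 0"
proof -
  have "(2 * (D \<bullet> (0 ** S - C)))\<^sup>2 \<le> 4 * (D \<bullet> (D ** S)) * L 0"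
  proof (rule quadratic_nonneg_discriminant(2))
    show "0 \<le> L 0 + 2 * (D \<bullet> (0 ** S - C)) * t + (D \<bullet> (D ** S)) * t\<^sup>2" for t
      using L_nonneg[of "0 + t *\<^sub>R D"] by (simp only: L_line)
  qed
  then show ?thesis
    using assms by (simp add: bilinear_lzero[OF bilinear_matrix_mult])
qed

lemma minimizer_iff: "is_arg_min L (\<lambda>_. True) W \<longleftrightarrow> W ** S = C"
proof
  assume "W ** S = C"
  then have "L W \<le> L V" for V
    using L_line[of W 1 "V - W"] form_nonneg[of "V - W"] by simp
  then show "is_arg_min L (\<lambda>_. True) W" by (auto simp: is_arg_min_def not_less)
next
  assume "is_arg_min L (\<lambda>_. True) W"
  then have min: "L W \<le> L V" for V by (auto simp: is_arg_min_def not_less)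
  \<comment> \<open>Half the gradient. Along it \<open>L - L W\<close> is a nonnegative quadratic
    with constant term 0, so its linear coefficient \<open>2 (D \<bullet> D)\<close>
    vanishes.\<close>
  define D where "D = W ** S - C"
  have "(2 * (D \<bullet> D))\<^sup>2 \<le> 4 * (D \<bullet> (D ** S)) * 0"
  proof (rule quadratic_nonneg_discriminant(2))
    show "0 \<le> 0 + 2 * (D \<bullet> D) * t + (D \<bullet> (D ** S)) * t\<^sup>2" for t
      using min[of "W + t *\<^sub>R D"] by (simp add: L_line D_def)
  qed
  then show "W ** S = C" by (simp add: D_def)
qed

lemma normal_equation_moore_penrose: "(C ** moore_penrose S) ** S = C"
proof -
  define X where "X = moore_penrose S"
  have "penrose S X" unfolding X_def moore_penrose_def by (rule theI'[OF ex1_penrose])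
  then have X: "S ** X ** S = S" "transpose (X ** S) = X ** S" by (auto simp: penrose_def)
  \<comment> \<open>The fourth Penrose condition makes \<open>P\<close> symmetric; the first gives
    \<open>S P = 0\<close>, hence also \<open>P S = 0\<close> and idempotence.\<close>
  define P where "P = mat 1 - X ** S"
  have trP: "transpose P = P"
    using X(2) by (simp add: P_def transpose_def vec_eq_iff mat_def)
  have SP: "S ** P = 0" using X(1) by (simp add: P_def matrix_mul_diff_ldistrib matrix_mul_assoc)
  have PS: "P ** S = 0"
    using arg_cong[OF SP, of transpose] trP sym_S
    by (simp add: matrix_transpose_mul) (simp add: transpose_def vec_eq_iff)
  have "X ** S ** P = 0"
    using SP by (simp add: matrix_mul_assoc[symmetric] bilinear_rzero[OF bilinear_matrix_mult])
  then have PP: "P ** P = P"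
    by (subst (1) P_def) (simp add: matrix_mult_diff_rdistrib)
  have "(C ** P) \<bullet> (C ** P) = (C ** P ** P) \<bullet> C"
    by (subst inner_matrix_mult_right) (simp add: trP inner_commute)
  also have "\<dots> = (C ** P) \<bullet> C" by (simp add: matrix_mul_assoc[symmetric] PP)
  also have "\<dots> = 0"
    by (rule inner_C_eq_0)
      (simp add: matrix_mul_assoc[symmetric] PS bilinear_rzero[OF bilinear_matrix_mult])
  finally have "C ** P = 0" by simp
  then show ?thesis
    by (simp add: P_def X_def matrix_mul_diff_ldistrib matrix_mul_assoc)
qed

lemma min_norm_minimizer_iff:
  "is_arg_min norm (is_arg_min L (\<lambda>_. True)) W \<longleftrightarrow> W = C ** moore_penrose S"
proof -
  define X where "X = moore_penrose S"
  have "penrose S X" unfolding X_def moore_penrose_def by (rule theI'[OF ex1_penrose])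
  then have X: "X ** S ** X = X" "transpose (S ** X) = S ** X" by (auto simp: penrose_def)
  have less: "norm (C ** X) < norm V" if "V ** S = C" "V \<noteq> C ** X" for V
  proof -
    define D where "D = V - C ** X"
    have DS: "D ** S = 0"
      using that normal_equation_moore_penrose
      by (simp add: D_def X_def matrix_mult_diff_rdistrib)
    \<comment> \<open>Expanding \<open>X = X (S X)\<close> with \<open>S X\<close> symmetric brings
      a factor \<open>S\<close> next to \<open>D\<close>, where \<open>D S = 0\<close>
      applies.\<close>
    have "D ** transpose X = D ** transpose (X ** (S ** X))"
      by (simp add: X(1) matrix_mul_assoc)
    also have "\<dots> = D ** S ** X ** transpose X"
      by (simp only: matrix_transpose_mul[of X] X(2)) (simp add: matrix_mul_assoc)
    also have "\<dots> = 0" by (simp add: DS bilinear_lzero[OF bilinear_matrix_mult])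
    finally have "(C ** X) \<bullet> D = 0" by (simp add: inner_matrix_mult_right)
    then have "(norm V)\<^sup>2 = (norm (C ** X))\<^sup>2 + (norm D)\<^sup>2"
      using norm_add_Pythagorean[of "C ** X" D] by (simp add: D_def orthogonal_def)
    moreover have "0 < (norm D)\<^sup>2" using that by (simp add: D_def)
    ultimately show ?thesis by (intro power2_less_imp_less[OF _ norm_ge_zero]) linarith
  qed
  have sol: "C ** X ** S = C" unfolding X_def by (rule normal_equation_moore_penrose)
  have le: "norm (C ** X) \<le> norm V" if "V ** S = C" for V
    using less[OF that] by (cases "V = C ** X") auto
  show ?thesis
    unfolding is_arg_min_def[of norm] minimizer_iff X_def[symmetric]
  proof
    assume W: "W ** S = C \<and> (\<nexists>V. V ** S = C \<and> norm V < norm W)"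
    then have "\<not> norm (C ** X) < norm W" using sol by blast
    then show "W = C ** X" using W less[of W] by blast
  next
    assume "W = C ** X"
    then show "W ** S = C \<and> (\<nexists>V. V ** S = C \<and> norm V < norm W)"
      using sol le by (simp add: linorder_not_less)
  qed
qed

lemma convex_on_L: "convex_on UNIV L"
proof (rule convex_onI)
  fix t :: real and V W :: "real^'n^'m"
  assume t: "0 < t" "t < 1"
  define Z D where "Z = (1 - t) *\<^sub>R V + t *\<^sub>R W" and "D = W - V"
  \<comment> \<open>Expanding both endpoints around the intermediate point \<open>Z\<close> makes
    the linear terms cancel in the convex combination.\<close>
  have V: "V = Z + (- t) *\<^sub>R D" and W: "W = Z + (1 - t) *\<^sub>R D"
    by (simp_all add: Z_def D_def algebra_simps)
  have "(1 - t) * L V + t * L W = L Z + t * (1 - t) * (D \<bullet> (D ** S))"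
    unfolding V W L_line by (simp add: algebra_simps power2_eq_square)
  then show "L ((1 - t) *\<^sub>R V + t *\<^sub>R W) \<le> (1 - t) * L V + t * L W"
    using t form_nonneg[of D] unfolding Z_def by simp
qed simp

lemma full_rank_minimizer_iff:
  assumes "rank S = CARD('n)"
  shows "is_arg_min L (\<lambda>_. True) W \<longleftrightarrow> W = C ** matrix_inv S"
proof -
  have "invertible S"
    using assms by (simp add: full_rank_injective matrix_left_invertible_injective[symmetric]
        invertible_left_inverse)
  then have "S ** matrix_inv S = mat 1 \<and> matrix_inv S ** S = mat 1"
    unfolding invertible_def matrix_inv_def by (rule someI_ex)
  then show ?thesis
    unfolding minimizer_iff by (metis matrix_mul_assoc matrix_mul_rid)
qed

lemma ex_null_direction:
  assumes "rank S \<noteq> CARD('n)"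
  obtains D :: "real^'n^'m" where "D \<noteq> 0" "D ** S = 0"
proof -
  have "\<not> inj ((*v) S)" using assms by (simp add: full_rank_injective)
  then obtain x where x: "S *v x = 0" "x \<noteq> 0"
    using matrix_left_invertible_injective matrix_left_invertible_ker by blast
  \<comment> \<open>Every row of the witness is the kernel vector \<open>x\<close>; symmetry of
    \<open>S\<close> makes \<open>x\<close> a left null vector too.\<close>
  show thesis
  proof
    show "((\<chi> i. x) :: real^'n^'m) \<noteq> 0" using x by (simp add: vec_eq_iff)
    have "x v* S = 0" using x by (metis sym_S transpose_matrix_vector)
    then show "(\<chi> i. x) ** S = (0 :: real^'n^'m)"
      by (simp add: matrix_matrix_mult_def vector_matrix_mult_def vec_eq_iff mult.commute)
  qed
qed

text \<open>A null direction through one solution of the normal equation yields a whole line of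
  solutions.\<close>

lemma infinite_minimizers:
  assumes "rank S \<noteq> CARD('n)"
  shows "infinite {W. is_arg_min L (\<lambda>_. True) W}"
proof -
  obtain D :: "real^'n^'m" where D: "D \<noteq> 0" "D ** S = 0" using assms by (rule ex_null_direction)
  define f :: "real \<Rightarrow> _" where "f t = C ** moore_penrose S + t *\<^sub>R D" for t
  have "inj f" using D by (auto simp: f_def inj_def)
  then have "infinite (range f)" by (simp add: finite_image_iff infinite_UNIV_char_0)
  moreover have "range f \<subseteq> {W. is_arg_min L (\<lambda>_. True) W}"
    using D normal_equation_moore_penrose
    by (auto simp: f_def minimizer_iff bilinear_ladd[OF bilinear_matrix_mult]
        bilinear_lmul[OF bilinear_matrix_mult])
  ultimately show ?thesis by (blast dest: finite_subset)
qed

lemma not_strictly_convex: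
  assumes "rank S \<noteq> CARD('n)"
  shows "\<not> strictly_convex_on UNIV L"
proof
  assume sc: "strictly_convex_on UNIV L"
  obtain D :: "real^'n^'m" where D: "D \<noteq> 0" "D ** S = 0" using assms by (rule ex_null_direction)
  \<comment> \<open>The quadratic term vanishes by \<open>D S = 0\<close> and the linear one by
    \<open>inner_C_eq_0\<close>, so strictness fails at the midpoint of 0 and
    \<open>D\<close>.\<close>
  have const: "L (t *\<^sub>R D) = L 0" for t
    using L_line[of 0 t D] D inner_C_eq_0[OF D(2)]
    by (simp add: bilinear_lzero[OF bilinear_matrix_mult])
  have "L ((1 - 1/2) *\<^sub>R 0 + (1/2) *\<^sub>R D) < (1 - 1/2) * L 0 + 1/2 * L D"
    by (rule sc[unfolded strictly_convex_on_def, THEN conjunct2, rule_format]) (use D(1) in auto)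
  then show False using const[of "1/2"] const[of 1] by simp
qed

end

section \<open>The expected squared loss as such a quadratic\<close>

lemma loss_eq_quadratic:
  fixes u :: "'w \<Rightarrow> real^'d::finite" and v :: "'k::finite \<Rightarrow> 'w \<Rightarrow> real^'d"
  defines "z \<equiv> \<lambda>\<omega>. stack (\<lambda>i. v i \<omega>)"
  assumes u: "u \<in> borel_measurable M" and v: "\<And>i. v i \<in> borel_measurable M"
    and iu: "integrable M (\<lambda>\<omega>. (norm (u \<omega>))\<^sup>2)"
    and iv: "\<And>i. integrable M (\<lambda>\<omega>. (norm (v i \<omega>))\<^sup>2)"
  shows "loss M u v W = (\<integral>\<omega>. (norm (u \<omega>))\<^sup>2 \<partial>M)
    - 2 * (W \<bullet> expectation_mat M (\<lambda>\<omega>. outer (u \<omega>) (z \<omega>)))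
    + W \<bullet> (W ** expectation_mat M (\<lambda>\<omega>. outer (z \<omega>) (z \<omega>)))"
proof -
  have z: "z \<in> borel_measurable M" unfolding z_def by (intro borel_measurable_stack v)
  have iz: "integrable M (\<lambda>\<omega>. (norm (z \<omega>))\<^sup>2)"
    unfolding z_def norm_stack_sq by (intro Bochner_Integration.integrable_sum iv)
  note uz = integrable_outer[OF u z iu iz] and zz = integrable_outer[OF z z iz iz]
  have lin: "bounded_linear (\<lambda>A. W \<bullet> (W ** A))"
    by (intro linear_conv_bounded_linear[THEN iffD1] linearI)
      (simp_all add: bilinear_radd[OF bilinear_matrix_mult] bilinear_rmul[OF bilinear_matrix_mult]
        inner_add_right)
  \<comment> \<open>Pointwise, the squared error is affine in the two outer products, so the
    expectation passes to the coefficients.\<close>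
  have "(norm (u \<omega> - W *v z \<omega>))\<^sup>2 = (norm (u \<omega>))\<^sup>2 - 2 * (W \<bullet> outer (u \<omega>) (z \<omega>))
      + W \<bullet> (W ** outer (z \<omega>) (z \<omega>))" for \<omega>
  proof -
    have "W ** outer (z \<omega>) (z \<omega>) = outer (W *v z \<omega>) (z \<omega>)"
      by (simp add: matrix_matrix_mult_def matrix_vector_mult_def outer_def vec_eq_iff
          sum_distrib_right mult.assoc)
    then have "W \<bullet> (W ** outer (z \<omega>) (z \<omega>)) = (W *v z \<omega>) \<bullet> (W *v z \<omega>)"
      by (simp only: inner_outer)
    then show ?thesis
      by (simp add: inner_outer power2_norm_eq_inner inner_diff_left inner_diff_right
          inner_commute[of "W *v z \<omega>" "u \<omega>"])
  qed
  then have "loss M u v W = (\<integral>\<omega>. (norm (u \<omega>))\<^sup>2 - 2 * (W \<bullet> outer (u \<omega>) (z \<omega>))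
      + W \<bullet> (W ** outer (z \<omega>) (z \<omega>)) \<partial>M)"
    by (simp add: loss_eq_stack z_def)
  also have "\<dots> = (\<integral>\<omega>. (norm (u \<omega>))\<^sup>2 \<partial>M) - 2 * (W \<bullet> (\<integral>\<omega>. outer (u \<omega>) (z \<omega>) \<partial>M))
      + W \<bullet> (W ** (\<integral>\<omega>. outer (z \<omega>) (z \<omega>) \<partial>M))"
    using iu uz integrable_bounded_linear[OF lin zz] integral_bounded_linear[OF lin zz] by simp
  finally show ?thesis by (simp add: expectation_mat_eq_integral uz zz)
qed

theorem mainTheorem1:
  fixes M :: "'w measure"
    and u :: "'w \<Rightarrow> real^'d::finite"
    and v :: "'k::finite \<Rightarrow> 'w \<Rightarrow> real^'d"
  defines "z \<equiv> \<lambda>\<omega>. stack (\<lambda>i. v i \<omega>)"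
  defines "L \<equiv> loss M u v"
  defines "Ezz \<equiv> expectation_mat M (\<lambda>\<omega>. outer (z \<omega>) (z \<omega>))"
  defines "Euz \<equiv> expectation_mat M (\<lambda>\<omega>. outer (u \<omega>) (z \<omega>))"
  assumes "prob_space M"
    and "u \<in> borel_measurable M"
    and "\<And>i. v i \<in> borel_measurable M"
    and "integrable M (\<lambda>\<omega>. (norm (u \<omega>))\<^sup>2)"
    and "\<And>i. integrable M (\<lambda>\<omega>. (norm (v i \<omega>))\<^sup>2)"
    and "prob_space.expectation M u = 0"
    and "\<And>i. prob_space.expectation M (v i) = 0"
  shows "(rank Ezz = CARD('k \<times> 'd) \<longrightarrow>
            (\<forall>W. is_arg_min L (\<lambda>_. True) W \<longleftrightarrow> W = Euz ** matrix_inv Ezz))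
       \<and> (rank Ezz \<noteq> CARD('k \<times> 'd) \<longrightarrow>
            convex_on UNIV L \<and> \<not> strictly_convex_on UNIV L
            \<and> infinite {W. is_arg_min L (\<lambda>_. True) W}
            \<and> (\<forall>W. is_arg_min norm (is_arg_min L (\<lambda>_. True)) W
                  \<longleftrightarrow> W = Euz ** moore_penrose Ezz))"
proof -
  have "least_squares_quadratic L Ezz Euz (\<integral>\<omega>. (norm (u \<omega>))\<^sup>2 \<partial>M)"
  proof
    show "L W = (\<integral>\<omega>. (norm (u \<omega>))\<^sup>2 \<partial>M) - 2 * (W \<bullet> Euz) + W \<bullet> (W ** Ezz)" for W
      unfolding L_def Euz_def Ezz_def z_def by (rule loss_eq_quadratic) (fact assms)+
    show "0 \<le> L W" for W by (simp add: L_def loss_def)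
    show "transpose Ezz = Ezz"
      by (simp add: Ezz_def expectation_mat_def outer_def transpose_def mult.commute)
  qed
  then interpret least_squares_quadratic L Ezz Euz "\<integral>\<omega>. (norm (u \<omega>))\<^sup>2 \<partial>M" .
  show ?thesis
    by (intro conjI impI allI full_rank_minimizer_iff convex_on_L not_strictly_convex
        infinite_minimizers min_norm_minimizer_iff)
qed

end
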